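(* Let $\epsilon>0$ (not necessarily constant with respect to the number $n$ of items). Then there is an online algorithm with advice for the general unbounded knapsack problem that uses $O((1/\epsilon)\log(n/\epsilon))$ advice bits on instances with $n$ items and has competitive ratio at most $1+\epsilon$.
   Context: Online general unbounded knapsack problem: knapsack capacity $1$; an instance is a sequence of items $x_1,\dots,x_n$ ($n$ unknown to the algorithm), item $x_i$ having a size $s_i\in[0,1]$ and a value $v_i\ge0$. Items arrive one by one; upon arrival of $x_i$ the algorithm irrevocably chooses a number $k_i\in\mathbb{N}_0$ of copies to pack, with the total packed size never exceeding $1$. $\mathrm{opt}(I)=\max\{\sum_i k_i v_i: k_i\in\mathbb{N}_0,\sum_i k_i s_i\le1\}$; the (strict) competitive ratio is $\sup_I \mathrm{opt}(I)/\mathrm{gain}(I)$ where $\mathrm{gain}(I)$ is the total packed value. Advice model (tape model): an oracle knowing the whole instance writes an infinite binary advice string, which the deterministic online algorithm may read from the beginning; the algorithm uses $f(n)$ advice bits if on every instance with $n$ items it reads at most the first $f(n)$ bits.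
   Formalization: The O-bound on advice bits is proved for ε(n) ≤ B (any fixed B, constant depending on B) and n/ε ≥ 2, as it is false for unbounded ε, e.g. ε = √n; the ratio ranges over instances whose optimum exists (no size-0 item of positive value). *)

theory Defs
  imports Complex_Main "HOL-Library.Extended_Real"
begin

datatype item = Item (item_size: real) (item_value: real)

definition valid_items :: "item list \<Rightarrow> bool" where
  "valid_items I \<longleftrightarrow>
     (\<forall>x \<in> set I. 0 \<le> item_size x \<and> item_size x \<le> 1 \<and> 0 \<le> item_value x)"

definition packed_size :: "item list \<Rightarrow> nat list \<Rightarrow> real" where
  "packed_size I ks = (\<Sum>i<length I. real (ks ! i) * item_size (I ! i))"

definition packed_value :: "item list \<Rightarrow> nat list \<Rightarrow> real" where
  "packed_value I ks = (\<Sum>i<length I. real (ks ! i) * item_value (I ! i))"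

definition packing_values :: "item list \<Rightarrow> real set" where
  "packing_values I =
     {packed_value I ks | ks. length ks = length I \<and> packed_size I ks \<le> 1}"

text \<open>For valid items, the maximum fails to exist exactly if some item has size zero
  and positive value.\<close>

definition has_opt :: "item list \<Rightarrow> bool" where
  "has_opt I \<longleftrightarrow> (\<exists>w \<in> packing_values I. \<forall>w' \<in> packing_values I. w' \<le> w)"

definition opt :: "item list \<Rightarrow> real" where
  "opt I = (GREATEST w. w \<in> packing_values I)"

type_synonym tape = "nat \<Rightarrow> bool"

datatype action = Read | Pack nat

text \<open>When serving an item, a deterministic algorithm sees the items revealed so far
  (the current one last), its earlier decisions, and the advice bits read so far. It either
  reads the next bit of the tape or irrevocably fixes the number of copies of the current
  item.\<close>

type_synonym algorithm = "item list \<Rightarrow> nat list \<Rightarrow> bool list \<Rightarrow> action"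

text \<open>\<open>run A \<phi> I ks m\<close>: on the item sequence \<open>I\<close> with tape \<open>\<phi>\<close>, algorithm \<open>A\<close> takes the
  decisions \<open>ks\<close> and has then read exactly the first \<open>m\<close> bits of \<open>\<phi>\<close>. There is no such run
  if \<open>A\<close> reads forever.\<close>

inductive run :: "algorithm \<Rightarrow> tape \<Rightarrow> item list \<Rightarrow> nat list \<Rightarrow> nat \<Rightarrow> bool"
  for A :: algorithm and \<phi> :: tape where
  run_Nil: "run A \<phi> [] [] 0"
| run_snoc: "\<lbrakk> run A \<phi> xs ks m; m \<le> m';
    \<And>j. \<lbrakk> m \<le> j; j < m' \<rbrakk> \<Longrightarrow> A (xs @ [x]) ks (map \<phi> [0..<j]) = Read;
    A (xs @ [x]) ks (map \<phi> [0..<m']) = Pack k \<rbrakk>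
    \<Longrightarrow> run A \<phi> (xs @ [x]) (ks @ [k]) m'"

lemma run_length: "run A \<phi> I ks m \<Longrightarrow> length ks = length I"
  by (induction rule: run.induct) auto

lemma run_deterministic:
  assumes "run A \<phi> I ks m" and "run A \<phi> I ks' m'"
  shows "ks' = ks \<and> m' = m"
  using assms
proof (induction arbitrary: ks' m' rule: run.induct)
  case run_Nil
  then show ?case by (cases rule: run.cases) auto
next
  case (run_snoc xs ks m n x k)
  from run_snoc.prems obtain ks1 m1 k1 where
    1: "ks' = ks1 @ [k1]" "run A \<phi> xs ks1 m1" "m1 \<le> m'"
      "\<And>j. m1 \<le> j \<Longrightarrow> j < m' \<Longrightarrow> A (xs @ [x]) ks1 (map \<phi> [0..<j]) = Read"
      "A (xs @ [x]) ks1 (map \<phi> [0..<m']) = Pack k1"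
    by (cases rule: run.cases) auto
  from run_snoc.IH[OF 1(2)] have 2: "ks1 = ks" "m1 = m" by auto
  have "\<not> m' < n" using run_snoc.hyps(3)[of m'] 1(3,5) 2 by auto
  moreover have "\<not> n < m'" using 1(4)[of n] run_snoc.hyps(2,4) 2 by auto
  ultimately show ?case using run_snoc.hyps(4) 1 2 by auto
qed

definition online_knapsack_algorithm :: "algorithm \<Rightarrow> bool" where
  "online_knapsack_algorithm A \<longleftrightarrow>
     (\<forall>\<phi> I ks m. valid_items I \<longrightarrow> run A \<phi> I ks m \<longrightarrow> packed_size I ks \<le> 1)"

definition gain :: "algorithm \<Rightarrow> tape \<Rightarrow> item list \<Rightarrow> real" where
  "gain A \<phi> I = packed_value I (THE ks. \<exists>m. run A \<phi> I ks m)"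

lemma gain_eq: "run A \<phi> I ks m \<Longrightarrow> gain A \<phi> I = packed_value I ks"
  unfolding gain_def by (rule arg_cong[where f = "packed_value I"], rule the_equality)
    (auto dest: run_deterministic)

type_synonym oracle_fun = "item list \<Rightarrow> tape"

definition uses_advice_bits :: "algorithm \<Rightarrow> oracle_fun \<Rightarrow> (nat \<Rightarrow> nat) \<Rightarrow> bool" where
  "uses_advice_bits A orc f \<longleftrightarrow>
     (\<forall>I. valid_items I \<longrightarrow> (\<exists>ks m. run A (orc I) I ks m \<and> m \<le> f (length I)))"

text \<open>The strict competitive ratio over the instances with \<open>n\<close> items. Division is that of
  the extended reals: \<open>a / 0 = \<infinity>\<close> for \<open>a > 0\<close>, whereas \<open>0 / 0 = 0\<close>.\<close>

definition competitive_ratio :: "algorithm \<Rightarrow> oracle_fun \<Rightarrow> nat \<Rightarrow> ereal" where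
  "competitive_ratio A orc n =
     (SUP I \<in> {I. valid_items I \<and> has_opt I \<and> length I = n}.
        ereal (opt I) / ereal (gain A (orc I) I))"

end

theory Submission
  imports Defs "HOL-Library.Multiset"
begin

text \<open>Fix an optimal packing and let \<open>K = \<lceil>2 + 2 / \<epsilon>\<rceil>\<close>. The advice names the \<open>K\<close> most valuable
  copies of the packing, which are packed exactly; every remaining copy is worth at most
  \<open>opt / K\<close>. The remaining copies are replaced by as many copies \<open>m\<close> of the densest item \<open>d\<close> among
  them as fit, which loses less than one copy of \<open>d\<close>. Neither \<open>m\<close> nor the space left for \<open>d\<close> is known
  when \<open>d\<close> arrives, and \<open>m\<close> may be too large to be transmitted; but the number \<open>M\<close> of copies of
  \<open>d\<close> that fit into an empty knapsack is known, and rounding \<open>m\<close> down to a multiple of \<open>M / K\<close> loses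
  at most another \<open>opt / K\<close>, since \<open>M\<close> copies of \<open>d\<close> are a packing. So \<open>K + 2\<close> numbers below
  \<open>n + K + 1\<close>, written in a prefix-free code, yield at least \<open>(1 - 2 / K) opt\<close>.\<close>

section \<open>Self-delimiting codes\<close>

definition list_code :: "('a \<Rightarrow> bool list) \<Rightarrow> 'a list \<Rightarrow> bool list" where
  "list_code c xs = concat (map (\<lambda>x. True # c x) xs) @ [False]"

text \<open>The flag in front of each entry tells whether the list goes on; if it does, the
  hypothesis on \<open>c\<close> strips off that entry whatever follows it. The end of the code is
  thus visible without knowing its length.\<close>

lemma list_code_prefix_free:
  assumes c: "\<And>x y u v. c x @ u = c y @ v \<Longrightarrow> x = y"
  shows "list_code c xs @ u = list_code c ys @ v \<Longrightarrow> xs = ys"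
proof (induction xs arbitrary: ys)
  case Nil
  then show ?case by (cases ys) (auto simp: list_code_def)
next
  case (Cons x xs)
  then obtain y ys' where ys: "ys = y # ys'" by (cases ys) (auto simp: list_code_def)
  have eq: "c x @ (list_code c xs @ u) = c y @ (list_code c ys' @ v)"
    using Cons.prems by (simp add: list_code_def ys)
  then have "x = y" by (rule c)
  with eq Cons.IH[of ys'] show ?case by (simp add: ys)
qed

lemma length_list_code:
  assumes "\<And>x. x \<in> set xs \<Longrightarrow> length (c x) \<le> l"
  shows "length (list_code c xs) \<le> 1 + length xs * (1 + l)"
  using assms
proof (induction xs)
  case (Cons x xs)
  have "length (list_code c xs) \<le> 1 + length xs * (1 + l)"
    by (rule Cons.IH) (simp add: Cons.prems)
  with Cons.prems[of x] show ?case by (simp add: list_code_def)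
qed (simp add: list_code_def)

fun bits :: "nat \<Rightarrow> bool list" where
  "bits n = (if n = 0 then [] else odd n # bits (n div 2))"

declare bits.simps [simp del]

lemma horner_sum_bits: "horner_sum of_bool 2 (bits n) = n"
  by (induction n rule: bits.induct, subst bits.simps) auto

lemma length_bits: "n < 2 ^ L \<Longrightarrow> length (bits n) \<le> L"
proof (induction L arbitrary: n)
  case (Suc L)
  then show ?case using Suc.IH[of "n div 2"] by (subst bits.simps) auto
qed (simp add: bits.simps)

text \<open>Binary expansions alone are not prefix-free, so \<open>list_code\<close> is used twice:
  on the bits of each number and on the list of numbers. A number of \<open>L\<close> bits costs
  \<open>1 + 2 * L\<close> bits, plus its flag in the outer list.\<close>

definition code :: "nat list \<Rightarrow> bool list" where
  "code = list_code (\<lambda>n. list_code (\<lambda>b. [b]) (bits n))"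

lemma code_prefix_free:
  assumes "code ns @ u = code ns' @ v"
  shows "ns = ns'"
proof (rule list_code_prefix_free)
  show "list_code (\<lambda>n. list_code (\<lambda>b. [b]) (bits n)) ns @ u =
      list_code (\<lambda>n. list_code (\<lambda>b. [b]) (bits n)) ns' @ v"
    using assms by (simp add: code_def)
next
  fix x y u v
  assume "list_code (\<lambda>b. [b]) (bits x) @ u = list_code (\<lambda>b. [b]) (bits y) @ v"
  then have "bits x = bits y" by (rule list_code_prefix_free[rotated]) simp
  then show "x = y" using horner_sum_bits by metis
qed

lemma inj_code: "inj code"
  using code_prefix_free by (metis injI)

lemma length_code:
  assumes "\<And>x. x \<in> set ns \<Longrightarrow> x < 2 ^ L"
  shows "length (code ns) \<le> 1 + length ns * (2 + 2 * L)"
proof -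
  have "length (list_code (\<lambda>b. [b]) (bits x)) \<le> 1 + 2 * L" if "x \<in> set ns" for x
    using length_list_code[of "bits x" "\<lambda>b. [b]" 1] length_bits[OF assms[OF that]] by simp
  from length_list_code[of ns "\<lambda>n. list_code (\<lambda>b. [b]) (bits n)", OF this]
  show ?thesis by (simp add: code_def)
qed

section \<open>The online algorithm and its runs\<close>

text \<open>A message \<open>d # j # cs\<close> lists in \<open>cs\<close> the indices of the copies to be packed exactly, and
  asks for a number of further copies of item \<open>d\<close>, namely the fraction \<open>j / length cs\<close> of the
  number of copies that fit into an empty knapsack. For size \<open>0\<close> that number is \<open>1 / 0 = 0\<close>.\<close>

fun copies :: "nat list \<Rightarrow> nat \<Rightarrow> item \<Rightarrow> nat" where
  "copies (d # j # cs) i x = count_list cs i +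
     (if i = d then nat \<lceil>real j * real (nat \<lfloor>1 / item_size x\<rfloor>) / real (length cs)\<rceil> else 0)"
| "copies _ i x = 0"

definition plan :: "nat list \<Rightarrow> item list \<Rightarrow> nat list" where
  "plan ns I = map (\<lambda>i. copies ns i (I ! i)) [0..<length I]"

text \<open>Reading stops at the first code word, so the message is read entirely at the first item.
  The fallback to 0 copies keeps the packing feasible on arbitrary tapes, as
  \<open>online_knapsack_algorithm\<close> demands.\<close>

definition knapsack_alg :: algorithm where
  "knapsack_alg xs ks bs =
     (if bs \<in> range code then
        let k = copies (inv code bs) (length ks) (last xs)
        in Pack (if packed_size xs (ks @ [k]) \<le> 1 then k else 0)
      else Read)"

definition tape_of :: "bool list \<Rightarrow> tape" where
  "tape_of bs j \<longleftrightarrow> j < length bs \<and> bs ! j"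

lemma map_tape_of: "j \<le> length bs \<Longrightarrow> map (tape_of bs) [0..<j] = take j bs"
  by (rule nth_equalityI) (auto simp: tape_of_def)

lemma packed_size_snoc:
  "length ks = length xs \<Longrightarrow>
   packed_size (xs @ [x]) (ks @ [k]) = packed_size xs ks + real k * item_size x"
  by (simp add: packed_size_def nth_append)

lemma plan_snoc: "plan ns (xs @ [x]) = plan ns xs @ [copies ns (length xs) x]"
  by (simp add: plan_def nth_append)

lemma length_plan [simp]: "length (plan ns I) = length I"
  by (simp add: plan_def)

lemma online_knapsack_alg: "online_knapsack_algorithm knapsack_alg"
proof -
  have "packed_size I ks \<le> 1" if "run knapsack_alg \<phi> I ks m" "valid_items I" for \<phi> I ks m
    using that
  proof (induction rule: run.induct)
    case run_Nil
    then show ?case by (simp add: packed_size_def)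
  next
    case (run_snoc xs ks m m' x k)
    then have "packed_size xs ks \<le> 1" by (simp add: valid_items_def)
    then show ?case using run_snoc.hyps(4) run_length[OF run_snoc.hyps(1)]
      by (auto simp: knapsack_alg_def Let_def packed_size_snoc split: if_splits)
  qed
  then show ?thesis by (auto simp: online_knapsack_algorithm_def)
qed

text \<open>Sizes are nonnegative, so a feasible plan is feasible on every prefix of
  \<open>I\<close> and the fallback changes nothing. Only an upper bound on \<open>m\<close> is
  kept, since the empty instance reads no bits.\<close>

lemma run_plan:
  assumes "valid_items I" "packed_size I (plan ns I) \<le> 1"
  shows "\<exists>m \<le> length (code ns). run knapsack_alg (tape_of (code ns)) I (plan ns I) m"
  using assms
proof (induction I rule: rev_induct)
  case Nil
  have "run knapsack_alg (tape_of (code ns)) [] [] 0" by (rule run_Nil)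
  then show ?case by (auto simp: plan_def)
next
  case (snoc x xs)
  let ?T = "length (code ns)" and ?k = "copies ns (length xs) x"
  have "0 \<le> item_size x" using snoc.prems by (simp add: valid_items_def)
  moreover have "packed_size xs (plan ns xs) + real ?k * item_size x \<le> 1"
    using snoc.prems by (simp add: plan_snoc packed_size_snoc)
  ultimately have "packed_size xs (plan ns xs) \<le> 1"
    by (smt (verit) mult_nonneg_nonneg of_nat_0_le_iff)
  moreover have "valid_items xs" using snoc.prems by (simp add: valid_items_def)
  ultimately obtain m where m: "m \<le> ?T" "run knapsack_alg (tape_of (code ns)) xs (plan ns xs) m"
    using snoc.IH by blast
  have "knapsack_alg (xs @ [x]) (plan ns xs) (map (tape_of (code ns)) [0..<j]) = Read"
    if "j < ?T" for j
  proof -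
    \<comment> \<open>A proper prefix of a code word is no code word, so reading cannot stop
      early.\<close>
    have "take j (code ns) \<noteq> code ns'" for ns'
    proof
      assume eq: "take j (code ns) = code ns'"
      have "code ns' @ drop j (code ns) = code ns @ []" by (simp flip: eq)
      then have "ns' = ns" by (rule code_prefix_free)
      with eq that show False by (metis length_take min.absorb4 nat_neq_iff)
    qed
    then show ?thesis using that by (auto simp: map_tape_of knapsack_alg_def)
  qed
  moreover have "knapsack_alg (xs @ [x]) (plan ns xs) (map (tape_of (code ns)) [0..<?T]) = Pack ?k"
    using snoc.prems by (simp add: map_tape_of knapsack_alg_def inj_code plan_snoc)
  ultimately have "run knapsack_alg (tape_of (code ns)) (xs @ [x]) (plan ns xs @ [?k]) ?T"
    using m by (intro run_snoc) auto
  then show ?case by (auto simp: plan_snoc)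
qed

section \<open>The optimum and optimal packings\<close>

lemma opt_witness:
  assumes "has_opt I"
  obtains ks where "length ks = length I" "packed_size I ks \<le> 1" "packed_value I ks = opt I"
proof -
  obtain w where w: "w \<in> packing_values I" "\<And>w'. w' \<in> packing_values I \<Longrightarrow> w' \<le> w"
    using assms by (auto simp: has_opt_def)
  then have "opt I = w" unfolding opt_def by (rule Greatest_equality)
  with w(1) that show ?thesis by (auto simp: packing_values_def)
qed

lemma opt_upper:
  assumes "has_opt I" and "(\<Sum>i<length I. real (c i) * item_size (I ! i)) \<le> 1"
  shows "(\<Sum>i<length I. real (c i) * item_value (I ! i)) \<le> opt I"
proof -
  obtain w where w: "w \<in> packing_values I" "\<And>w'. w' \<in> packing_values I \<Longrightarrow> w' \<le> w"
    using assms(1) by (auto simp: has_opt_def)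
  then have "opt I = w" unfolding opt_def by (rule Greatest_equality)
  moreover have "packed_value I (map c [0..<length I]) \<in> packing_values I"
    using assms(2) by (auto simp: packing_values_def packed_size_def intro!: exI[of _ "map c [0..<length I]"])
  ultimately show ?thesis using w(2) by (simp add: packed_value_def)
qed

lemma sum_count_list:
  fixes f :: "nat \<Rightarrow> real"
  assumes "set xs \<subseteq> {..<n}"
  shows "(\<Sum>i<n. real (count_list xs i) * f i) = sum_list (map f xs)"
  using assms
proof (induction xs)
  case (Cons x xs)
  have "(\<Sum>i<n. real (count_list (x # xs) i) * f i)
      = (\<Sum>i<n. real (count_list xs i) * f i + (if i = x then f i else 0))"
    by (rule sum.cong) (auto simp: algebra_simps)
  with Cons show ?case by (simp add: sum.distrib)
qed simp

lemma count_list_concat_replicate: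
  assumes "i < n"
  shows "count_list (concat (map (\<lambda>i. replicate (g i) i) [0..<n])) i = g i"
proof -
  have rep: "count_list (replicate k a) i = (if a = i then k else 0)" for k a
    by (induction k) auto
  have "count_list (concat (map (\<lambda>i. replicate (g i) i) [0..<n])) i = (if i < n then g i else 0)"
    by (induction n) (auto simp: rep)
  with assms show ?thesis by simp
qed

text \<open>With one list entry per copy, the \<open>K\<close> most valuable copies become an
  initial segment of the sorted list, even when they split the copies of one item.\<close>

lemma opt_multiset:
  assumes "valid_items I" "has_opt I"
  obtains js where "set js \<subseteq> {..<length I}" "(\<Sum>i\<leftarrow>js. item_size (I ! i)) \<le> 1"
    "(\<Sum>i\<leftarrow>js. item_value (I ! i)) = opt I"
    "sorted_wrt (\<lambda>i j. item_value (I ! i) \<ge> item_value (I ! j)) js"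
proof -
  obtain ks where ks: "length ks = length I" "packed_size I ks \<le> 1" "packed_value I ks = opt I"
    using opt_witness[OF assms(2)] .
  define js0 where "js0 = concat (map (\<lambda>i. replicate (ks ! i) i) [0..<length I])"
  define js where "js = sort_key (\<lambda>i. - item_value (I ! i)) js0"
  have mset: "mset js = mset js0" by (simp add: js_def)
  have set0: "set js0 \<subseteq> {..<length I}" by (auto simp: js0_def)
  have sum: "(\<Sum>i\<leftarrow>js. f i) = (\<Sum>i<length I. real (ks ! i) * f i)" for f :: "nat \<Rightarrow> real"
  proof -
    have "(\<Sum>i\<leftarrow>js. f i) = (\<Sum>i\<leftarrow>js0. f i)"
      by (metis mset mset_map sum_mset_sum_list)
    also have "\<dots> = (\<Sum>i<length I. real (count_list js0 i) * f i)"
      by (rule sum_count_list[OF set0, symmetric])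
    also have "\<dots> = (\<Sum>i<length I. real (ks ! i) * f i)"
      by (rule sum.cong) (simp_all add: js0_def count_list_concat_replicate)
    finally show ?thesis .
  qed
  show ?thesis
  proof
    show "set js \<subseteq> {..<length I}" using set0 by (simp add: js_def)
    show "sorted_wrt (\<lambda>i j. item_value (I ! i) \<ge> item_value (I ! j)) js"
      using sorted_sort_key[of "\<lambda>i. - item_value (I ! i)" js0]
      by (simp add: js_def sorted_map)
  qed (use ks in \<open>auto simp: sum packed_size_def packed_value_def\<close>)
qed

text \<open>Otherwise arbitrarily many copies would fit and no optimum could exist. This settles the
  items whose density is undefined.\<close>

lemma value_zero_if_size_zero:
  assumes I: "valid_items I" "has_opt I" and i: "i < length I" "item_size (I ! i) = 0"
  shows "item_value (I ! i) = 0"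
proof (rule ccontr)
  assume "item_value (I ! i) \<noteq> 0"
  moreover have "0 \<le> item_value (I ! i)" using I(1) i(1) by (simp add: valid_items_def)
  ultimately have pos: "item_value (I ! i) > 0" by simp
  define N where "N = nat \<lceil>opt I / item_value (I ! i)\<rceil> + 1"
  have *: "(\<Sum>k<length I. real (if k = i then N else 0) * f k) = real N * f i" for f
  proof -
    have "(\<Sum>k<length I. real (if k = i then N else 0) * f k)
        = (\<Sum>k<length I. if k = i then real N * f k else 0)"
      by (rule sum.cong) auto
    then show ?thesis using i(1) by simp
  qed
  have "real N * item_value (I ! i) \<le> opt I"
    using opt_upper[OF I(2), of "\<lambda>k. if k = i then N else 0"] i(2) by (simp only: *)
  then have "real N \<le> opt I / item_value (I ! i)" using pos by (simp add: field_simps)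
  moreover have "opt I / item_value (I ! i) < real N" unfolding N_def by linarith
  ultimately show False by simp
qed

section \<open>Choice of the message: exact copies and filler\<close>

lemma plan_sum:
  fixes f :: "item \<Rightarrow> real"
  assumes "set cs \<subseteq> {..<length I}" "d < length I"
  shows "(\<Sum>i<length I. real (plan (d # j # cs) I ! i) * f (I ! i)) = (\<Sum>i\<leftarrow>cs. f (I ! i)) +
    real (nat \<lceil>real j * real (nat \<lfloor>1 / item_size (I ! d)\<rfloor>) / real (length cs)\<rceil>) * f (I ! d)"
    (is "?l = _ + ?m * _")
proof -
  have "?l = (\<Sum>i<length I. real (count_list cs i) * f (I ! i) + (if i = d then ?m * f (I ! d) else 0))"
    by (rule sum.cong) (auto simp: plan_def algebra_simps)
  also have "\<dots> = (\<Sum>i<length I. real (count_list cs i) * f (I ! i)) + ?m * f (I ! d)"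
    using assms(2) by (simp add: sum.distrib)
  finally show ?thesis using sum_count_list[OF assms(1), of "\<lambda>i. f (I ! i)"] by simp
qed

text \<open>The index \<open>d\<close> maximises \<open>v i / s i\<close>. The product form can be
  summed over copies, which bounds their total value by density times total size.\<close>

lemma densest_item:
  assumes "finite S" "S \<noteq> {}" "\<And>i. i \<in> S \<Longrightarrow> 0 < (s i :: real)"
  obtains d where "d \<in> S" "\<And>i. i \<in> S \<Longrightarrow> v i \<le> v d / s d * s i"
proof -
  have fin: "finite ((\<lambda>i. v i / s i) ` S)" "(\<lambda>i. v i / s i) ` S \<noteq> {}" using assms by auto
  obtain d where d: "d \<in> S" "v d / s d = Max ((\<lambda>i. v i / s i) ` S)"
    using Max_in[OF fin] by auto
  have "v i \<le> v d / s d * s i" if "i \<in> S" for i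
  proof -
    have "v i / s i \<le> v d / s d" unfolding d(2) using fin that by auto
    then show ?thesis using assms(3)[OF that] by (simp add: pos_divide_le_eq)
  qed
  with d(1) that show ?thesis by blast
qed

text \<open>Rounding \<open>m * K / M\<close> down to \<open>j\<close> loses less than 1, that is,
  less than \<open>M / K\<close> copies. Rounding \<open>j * M / K\<close> up again cannot exceed
  \<open>m\<close>, because \<open>m\<close> is an integer.\<close>

lemma rounding:
  fixes m M K :: nat
  assumes "m \<le> M" "0 < M" "0 < K"
  defines "j \<equiv> m * K div M"
  defines "m' \<equiv> nat \<lceil>real j * real M / real K\<rceil>"
  shows "j \<le> K" "m' \<le> m" "real m \<le> real m' + real M / real K"
proof -
  have "m * K div M \<le> M * K div M" by (rule div_le_mono) (simp add: assms)
  then show "j \<le> K" using assms by simp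
  have "j * M \<le> m * K" by (simp add: j_def)
  then have "real j * real M \<le> real m * real K" by (metis of_nat_le_iff of_nat_mult)
  then have "real j * real M / real K \<le> real m" using assms by (simp add: pos_divide_le_eq)
  then show "m' \<le> m" unfolding m'_def by linarith
  have "m * K \<le> j * M + M" using assms(2) div_mult_mod_eq[of "m * K" M] mod_less_divisor[of M "m * K"]
    unfolding j_def by linarith
  then have "real m * real K \<le> real j * real M + real M" by (metis of_nat_le_iff of_nat_mult of_nat_add)
  then have "real m \<le> real j * real M / real K + real M / real K"
    using assms(3) by (simp add: field_simps)
  then show "real m \<le> real m' + real M / real K" unfolding m'_def by linarith
qed

lemma nonempty_message:
  assumes I: "valid_items I" "has_opt I" "I \<noteq> []" and K: "0 < K"
  shows "\<exists>ns. length ns \<le> K + 2 \<and> (\<forall>x \<in> set ns. x < length I + K + 1) \<and>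
    packed_size I (plan ns I) \<le> 1 \<and> (1 - 2 / real K) * opt I \<le> packed_value I (plan ns I)"
proof -
  let ?n = "length I"
  define s v where "s i = item_size (I ! i)" and "v i = item_value (I ! i)" for i
  have bnd: "0 \<le> s i" "s i \<le> 1" "0 \<le> v i" if "i < ?n" for i
    using I(1) that by (auto simp: valid_items_def s_def v_def)
  obtain js where js: "set js \<subseteq> {..<?n}" "(\<Sum>i\<leftarrow>js. s i) \<le> 1" "(\<Sum>i\<leftarrow>js. v i) = opt I"
    "sorted_wrt (\<lambda>i j. v i \<ge> v j) js"
    using opt_multiset[OF I(1,2)] unfolding s_def v_def by blast
  define cs rest where "cs = take K js" and "rest = drop K js"
  have js_eq: "js = cs @ rest" by (simp add: cs_def rest_def)
  have sets: "set cs \<subseteq> {..<?n}" "set rest \<subseteq> {..<?n}" using js(1) by (auto simp: js_eq)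
  have len: "length cs \<le> K" by (simp add: cs_def)
  have opt0: "0 \<le> opt I" using js(1) bnd(3) unfolding js(3)[symmetric] by (intro sum_list_nonneg) auto
  have sz: "(\<Sum>i\<leftarrow>cs. s i) + (\<Sum>i\<leftarrow>rest. s i) \<le> 1" using js(2) by (simp add: js_eq)
  have va: "(\<Sum>i\<leftarrow>cs. v i) + (\<Sum>i\<leftarrow>rest. v i) = opt I" using js(3) by (simp add: js_eq)
  have s0: "0 \<le> (\<Sum>i\<leftarrow>cs. s i)" "0 \<le> (\<Sum>i\<leftarrow>rest. s i)"
    using sets bnd(1) by (auto 4 4 intro!: sum_list_nonneg)
  have packed: "packed_size I (plan (d # j # cs) I) = (\<Sum>i\<leftarrow>cs. s i) +
      real (nat \<lceil>real j * real (nat \<lfloor>1 / s d\<rfloor>) / real (length cs)\<rceil>) * s d"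
    "packed_value I (plan (d # j # cs) I) = (\<Sum>i\<leftarrow>cs. v i) +
      real (nat \<lceil>real j * real (nat \<lfloor>1 / s d\<rfloor>) / real (length cs)\<rceil>) * v d"
    if "d < ?n" for d j
    unfolding packed_size_def packed_value_def s_def v_def by (rule plan_sum[OF sets(1) that])+
  define S where "S = {i \<in> set rest. 0 < s i}"
  show ?thesis
  proof (cases "S = {}")
    case True
    have "v i = 0" if "i \<in> set rest" for i
    proof -
      have "i < ?n" using sets(2) that by auto
      moreover have "\<not> 0 < s i" using True that by (simp add: S_def)
      ultimately show ?thesis
        using value_zero_if_size_zero[OF I(1,2), of i] bnd(1)[of i] by (simp add: s_def v_def)
    qed
    then have "map v rest = map (\<lambda>_. 0) rest" by (intro map_cong) auto
    then have "(\<Sum>i\<leftarrow>rest. v i) = 0" by (simp only: sum_list_0)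
    then have "opt I = (\<Sum>i\<leftarrow>cs. v i)" using va by simp
    moreover have "(1 - 2 / real K) * opt I \<le> 1 * opt I"
      by (rule mult_right_mono) (auto simp: opt0)
    moreover have "\<forall>x \<in> set (0 # 0 # cs). x < ?n + K + 1" using sets by auto
    moreover have "(\<Sum>i\<leftarrow>cs. s i) \<le> 1" using sz s0 by linarith
    \<comment> \<open>The second entry 0 requests no filler, and index 0 exists because
      \<open>I\<close> is nonempty.\<close>
    ultimately show ?thesis using len I(3)
      by (intro exI[of _ "0 # 0 # cs"]) (simp add: packed)
  next
    case False
    obtain d where d: "d \<in> S" "\<And>i. i \<in> S \<Longrightarrow> v i \<le> v d / s d * s i"
    proof (rule densest_item[of S s v])
      show "finite S" "S \<noteq> {}" "\<And>i. i \<in> S \<Longrightarrow> 0 < s i" using False by (simp_all add: S_def)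
    qed blast
    have dn: "d < ?n" "0 < s d" "d \<in> set rest" using d(1) sets by (auto simp: S_def)
    \<comment> \<open>As \<open>rest\<close> is nonempty, \<open>take K\<close> is filled
      completely. The algorithm does not know \<open>K\<close> and recovers it as
      \<open>length cs\<close>.\<close>
    have lenK: "length cs = K" using dn(3) by (cases "length js \<le> K") (auto simp: cs_def rest_def)
    define M where "M = nat \<lfloor>1 / s d\<rfloor>"
    define m where "m = nat \<lfloor>(1 - (\<Sum>i\<leftarrow>cs. s i)) / s d\<rfloor>"
    define j where "j = m * K div M"
    define m' where "m' = nat \<lceil>real j * real M / real K\<rceil>"
    have "1 \<le> 1 / s d" using dn bnd(2) by simp
    then have M: "0 < M" "real M \<le> 1 / s d" unfolding M_def by linarith+
    have "(1 - (\<Sum>i\<leftarrow>cs. s i)) / s d \<le> 1 / s d" using s0 dn by (intro divide_right_mono) auto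
    then have mM: "m \<le> M" unfolding m_def M_def by (intro nat_mono floor_mono)
    have "0 \<le> (1 - (\<Sum>i\<leftarrow>cs. s i)) / s d" using sz s0 dn by auto
    then have m: "real m \<le> (1 - (\<Sum>i\<leftarrow>cs. s i)) / s d" "(1 - (\<Sum>i\<leftarrow>cs. s i)) / s d \<le> real m + 1"
      unfolding m_def by linarith+
    note r = rounding[OF mM M(1) K, folded j_def, folded m'_def]
    have "M * s d \<le> 1" using M(2) dn by (simp add: field_simps)
    moreover have single: "(\<Sum>k<?n. real (if k = d then M else 0) * f k) = real M * f d" for f
    proof -
      have "(\<Sum>k<?n. real (if k = d then M else 0) * f k) = (\<Sum>k<?n. if k = d then real M * f k else 0)"
        by (rule sum.cong) auto
      then show ?thesis using dn(1) by simp
    qed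
    ultimately have Mopt: "M * v d \<le> opt I"
      using opt_upper[OF I(2), of "\<lambda>k. if k = d then M else 0", folded s_def v_def]
      unfolding single by blast
    \<comment> \<open>All entries of \<open>cs\<close> come before \<open>d\<close> in the sorted
      list \<open>js\<close>, so each is worth at least \<open>v d\<close>. Hence one copy of
      \<open>d\<close> is worth at most \<open>opt I / K\<close>.\<close>
    have "real K * v d = (\<Sum>i\<leftarrow>cs. v d)" by (simp add: lenK sum_list_triv)
    also have "\<dots> \<le> (\<Sum>i\<leftarrow>cs. v i)"
      using js(4) dn(3) by (intro sum_list_mono) (auto simp: js_eq sorted_wrt_append)
    also have "\<dots> \<le> opt I" using va sets(2) bnd(3)
      by (smt (verit) sum_list_nonneg image_iff lessThan_iff list.set_map subset_iff)
    finally have Kopt: "real K * v d \<le> opt I" .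
    \<comment> \<open>At the density of \<open>d\<close>, the space left by \<open>cs\<close> is
      worth at most \<open>m + 1\<close> copies of \<open>d\<close>. Replacing these by
      \<open>m'\<close> copies loses one copy and at most \<open>M / K\<close> further ones;
      \<open>Kopt\<close> and \<open>Mopt\<close> bound each loss by
      \<open>opt I / K\<close>.\<close>
    have "(\<Sum>i\<leftarrow>rest. v i) \<le> (\<Sum>i\<leftarrow>rest. v d / s d * s i)"
    proof (rule sum_list_mono)
      fix i assume i: "i \<in> set rest"
      then have "i < ?n" using sets by auto
      then show "v i \<le> v d / s d * s i"
        using d(2)[of i] i value_zero_if_size_zero[OF I(1,2), of i] bnd(1)[of i]
        by (cases "s i = 0") (auto simp: S_def s_def v_def)
    qed
    also have "\<dots> = v d / s d * (\<Sum>i\<leftarrow>rest. s i)" by (rule sum_list_const_mult)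
    also have "\<dots> \<le> v d / s d * (1 - (\<Sum>i\<leftarrow>cs. s i))"
      using sz dn bnd(3)[of d] by (intro mult_left_mono) auto
    also have "\<dots> = v d * ((1 - (\<Sum>i\<leftarrow>cs. s i)) / s d)" by simp
    also have "\<dots> \<le> v d * (real m + 1)" using m(2) bnd(3)[OF dn(1)] by (rule mult_left_mono)
    also have "\<dots> \<le> v d * (real m' + real M / real K + 1)"
      using r(3) bnd(3)[OF dn(1)] by (intro mult_left_mono) auto
    also have "\<dots> = real m' * v d + real M * v d / real K + v d" by (simp add: algebra_simps)
    also have "\<dots> \<le> real m' * v d + opt I / real K + opt I / real K"
      using Mopt Kopt K by (intro add_mono divide_right_mono) (auto simp: field_simps)
    finally have "(1 - 2 / real K) * opt I \<le> (\<Sum>i\<leftarrow>cs. v i) + real m' * v d"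
      using va by (simp add: algebra_simps)
    moreover have "real m' * s d \<le> 1 - (\<Sum>i\<leftarrow>cs. s i)"
    proof -
      have "real m' * s d \<le> real m * s d" using r(2) dn by (intro mult_right_mono) auto
      also have "\<dots> \<le> 1 - (\<Sum>i\<leftarrow>cs. s i)" using m(1) dn by (simp add: field_simps)
      finally show ?thesis .
    qed
    moreover have "\<forall>x \<in> set (d # j # cs). x < ?n + K + 1" using sets dn r(1) by auto
    moreover note packed[OF dn(1), of j, folded M_def, unfolded lenK, folded m'_def]
    ultimately show ?thesis using lenK by (intro exI[of _ "d # j # cs"]) simp
  qed
qed

text \<open>Since \<open>uses_advice_bits\<close> covers every valid instance, the empty one and
  those without an optimum need a message too; the empty message, which packs nothing, serves
  them.\<close>

lemma message_exists:
  assumes "valid_items I" "0 < K"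
  shows "\<exists>ns. length ns \<le> K + 2 \<and> (\<forall>x \<in> set ns. x < length I + K + 1) \<and>
    packed_size I (plan ns I) \<le> 1 \<and>
    (has_opt I \<longrightarrow> (1 - 2 / real K) * opt I \<le> packed_value I (plan ns I))"
proof (cases "has_opt I \<and> I \<noteq> []")
  case True
  with nonempty_message[OF assms(1) _ _ assms(2)] show ?thesis by blast
next
  case False
  have "opt I = 0" if "has_opt I"
    using opt_witness[OF that] False that by (auto simp: packed_value_def)
  then show ?thesis using False
    by (intro exI[of _ "[]"]) (auto simp: plan_def packed_size_def packed_value_def)
qed

section \<open>Competitive ratio and advice length\<close>

lemma opt_nonneg: "has_opt I \<Longrightarrow> 0 \<le> opt I"
  using opt_upper[of I "\<lambda>_. 0"] by simp

text \<open>The bound on \<open>K\<close> is a rearrangement of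
  \<open>1 \<le> (1 + e) * (1 - 2 / K)\<close>. If \<open>p = 0\<close>, the gain may vanish too,
  and the convention \<open>0 / 0 = 0\<close> applies.\<close>

lemma ratio_le:
  assumes K: "2 + 2 / e \<le> K" and e: "0 < e" and p: "0 \<le> p" and g: "(1 - 2 / K) * p \<le> g"
  shows "ereal p / ereal g \<le> ereal (1 + e)"
proof -
  have K0: "0 < K" "2 < K" using K e by (smt (verit) divide_pos_pos)+
  have "2 * (1 + e) \<le> K * e" using K e by (simp add: field_simps)
  then have "1 \<le> (1 + e) * (1 - 2 / K)" using K0 by (simp add: field_simps)
  then have "1 * p \<le> (1 + e) * (1 - 2 / K) * p" using p by (rule mult_right_mono)
  also have "\<dots> \<le> (1 + e) * g" using g e by (simp add: mult.assoc)
  finally have le: "p \<le> (1 + e) * g" by simp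
  show ?thesis
  proof (cases "p = 0")
    case True
    then show ?thesis using e by (simp flip: zero_ereal_def)
  next
    case False
    have "0 < (1 - 2 / K) * p" using False p K0 by (intro mult_pos_pos) auto
    with g have "0 < g" by linarith
    then show ?thesis using le by (simp add: pos_divide_le_eq)
  qed
qed

text \<open>The hypotheses give \<open>1 \<le> B / e\<close> and
  \<open>1 \<le> log 2 (n / e)\<close>, so additive constants are absorbed into multiples of
  \<open>1 / e\<close> and of the logarithm.\<close>

lemma advice_bound:
  fixes n :: nat and e B :: real
  assumes "0 < B" "0 < e" "e \<le> B" "2 \<le> real n / e"
  defines "K \<equiv> nat \<lceil>2 + 2 / e\<rceil>"
  defines "L \<equiv> nat \<lceil>log 2 (real (n + K + 1))\<rceil>"
  shows "real (1 + (K + 2) * (2 + 2 * L))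
    \<le> (B + (5 * B + 2) * (6 + 2 * log 2 (5 * B + 2))) * ((1 / e) * log 2 (real n / e))"
proof -
  define X where "X = real n / e"
  define b where "b = log 2 (5 * B + 2)"
  have X: "2 \<le> X" using assms by (simp add: X_def)
  have lX: "1 \<le> log 2 X" using X by (simp add: le_log_iff)
  have b: "0 \<le> b" using assms(1) by (simp add: b_def)
  have n1: "1 \<le> real n" using X assms(2) by (cases n) (auto simp: X_def)
  have Be: "1 \<le> B / e" using assms by simp
  have e2: "0 \<le> 2 / e" using assms(2) by simp
  have K: "real K \<le> 3 + 2 / e" unfolding K_def using e2 by linarith
  then have K2: "real K + 2 \<le> (5 * B + 2) / e" using Be by (simp add: add_divide_distrib)
  \<comment> \<open>The factor \<open>5 * B + 2\<close> arises from \<open>n\<close> (giving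
    \<open>B\<close>) and \<open>4 + 2 / e\<close> (giving \<open>4 * B + 2\<close>), each scaled by
    \<open>n / e\<close>.\<close>
  have "real (n + K + 1) \<le> real n + (4 + 2 / e)" using K by simp
  also have "\<dots> \<le> real n * (B / e) + real n * ((4 * B + 2) / e)"
  proof (rule add_mono)
    show "real n \<le> real n * (B / e)" using mult_left_mono[OF Be, of "real n"] by simp
    have "4 + 2 / e \<le> (4 * B + 2) / e" using Be by (simp add: add_divide_distrib)
    also have "\<dots> \<le> real n * ((4 * B + 2) / e)"
      using mult_right_mono[OF n1, of "(4 * B + 2) / e"] assms(1,2) by simp
    finally show "4 + 2 / e \<le> real n * ((4 * B + 2) / e)" by simp
  qed
  also have "\<dots> = (5 * B + 2) * X" using assms(2) by (simp add: X_def field_simps)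
  finally have "log 2 (real (n + K + 1)) \<le> log 2 ((5 * B + 2) * X)" by (subst log_le_cancel_iff) auto
  also have "\<dots> = b + log 2 X" using assms(1) X by (simp add: b_def log_mult)
  finally have "real L \<le> b + log 2 X + 1" unfolding L_def using b lX by linarith
  also have "\<dots> \<le> (b + 2) * log 2 X"
    using mult_left_mono[OF lX b] lX by (simp add: algebra_simps)
  finally have L: "2 + 2 * real L \<le> (6 + 2 * b) * log 2 X" using lX by (simp add: algebra_simps)
  have "1 \<le> B / e * log 2 X" using mult_mono[OF Be lX] Be by simp
  moreover have "(real K + 2) * (2 + 2 * real L) \<le> (5 * B + 2) / e * ((6 + 2 * b) * log 2 X)"
    using K2 L assms(1,2) by (intro mult_mono) auto
  ultimately have "1 + (real K + 2) * (2 + 2 * real L)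
      \<le> B / e * log 2 X + (5 * B + 2) / e * ((6 + 2 * b) * log 2 X)" by simp
  also have "\<dots> = (B + (5 * B + 2) * (6 + 2 * b)) * ((1 / e) * log 2 X)"
    using assms(2) by (simp add: field_simps)
  finally show ?thesis by (simp only: X_def b_def of_nat_add of_nat_mult of_nat_1 of_nat_numeral)
qed

text \<open>The constant depends on \<open>B\<close> alone, so the bound is uniform in
  \<open>\<epsilon>\<close>. Outside the stated range
  \<open>(1 / \<epsilon> n) * log 2 (n / \<epsilon> n)\<close> can be arbitrarily close to 0 or
  negative, whereas the \<open>f\<close> constructed here is always positive.\<close>

theorem theorem10:
  "\<forall>B::real. 0 < B \<longrightarrow>
    (\<exists>C::real. \<forall>\<epsilon> :: nat \<Rightarrow> real. (\<forall>n. 0 < \<epsilon> n) \<longrightarrow>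
      (\<exists>A orc f.
         online_knapsack_algorithm A \<and>
         uses_advice_bits A orc f \<and>
         (\<forall>n. competitive_ratio A orc n \<le> ereal (1 + \<epsilon> n)) \<and>
         (\<forall>n. \<epsilon> n \<le> B \<and> 2 \<le> real n / \<epsilon> n \<longrightarrow>
            real (f n) \<le> C * ((1 / \<epsilon> n) * log 2 (real n / \<epsilon> n)))))"
proof (intro allI impI)
  fix B :: real
  assume B: "0 < B"
  show "\<exists>C::real. \<forall>\<epsilon> :: nat \<Rightarrow> real. (\<forall>n. 0 < \<epsilon> n) \<longrightarrow>
      (\<exists>A orc f.
         online_knapsack_algorithm A \<and>
         uses_advice_bits A orc f \<and>
         (\<forall>n. competitive_ratio A orc n \<le> ereal (1 + \<epsilon> n)) \<and>
         (\<forall>n. \<epsilon> n \<le> B \<and> 2 \<le> real n / \<epsilon> n \<longrightarrow>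
            real (f n) \<le> C * ((1 / \<epsilon> n) * log 2 (real n / \<epsilon> n))))"
  proof (intro exI allI impI)
    fix \<epsilon> :: "nat \<Rightarrow> real"
    assume \<epsilon>: "\<forall>n. 0 < \<epsilon> n"
    define K where "K n = nat \<lceil>2 + 2 / \<epsilon> n\<rceil>" for n
    define L where "L n = nat \<lceil>log 2 (real (n + K n + 1))\<rceil>" for n
    define f where "f n = 1 + (K n + 2) * (2 + 2 * L n)" for n
    have K: "2 + 2 / \<epsilon> n \<le> real (K n)" for n unfolding K_def by linarith
    have K0: "0 < K n" for n
    proof -
      have "0 < 2 / \<epsilon> n" using \<epsilon> by simp
      then show ?thesis using K[of n] by linarith
    qed
    have L: "n + K n + 1 \<le> 2 ^ L n" for n
    proof -
      have "log 2 (real (n + K n + 1)) \<le> real (L n)" unfolding L_def by linarith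
      then have "real (n + K n + 1) \<le> 2 powr real (L n)" by (subst (asm) log_le_iff) auto
      also have "\<dots> = real (2 ^ L n)" by (simp add: powr_realpow)
      finally show ?thesis by (simp only: of_nat_le_iff)
    qed
    define good where "good I ns \<longleftrightarrow> length ns \<le> K (length I) + 2 \<and>
      (\<forall>x \<in> set ns. x < length I + K (length I) + 1) \<and> packed_size I (plan ns I) \<le> 1 \<and>
      (has_opt I \<longrightarrow> (1 - 2 / real (K (length I))) * opt I \<le> packed_value I (plan ns I))" for I ns
    \<comment> \<open>The oracle sees \<open>length I\<close> and hence the right \<open>K\<close>;
      \<open>knapsack_alg\<close> depends on neither \<open>n\<close> nor
      \<open>\<epsilon>\<close>.\<close>
    define msg where "msg I = (SOME ns. good I ns)" for I
    define orc where "orc I = tape_of (code (msg I))" for I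
    have msg: "good I (msg I)" if "valid_items I" for I
      unfolding msg_def using message_exists[OF that K0[of "length I"]]
      by (intro someI_ex[of "good I"]) (auto simp: good_def)
    have run: "\<exists>m \<le> f (length I). run knapsack_alg (orc I) I (plan (msg I) I) m"
      if "valid_items I" for I
    proof -
      have "length (code (msg I)) \<le> 1 + length (msg I) * (2 + 2 * L (length I))"
        using msg[OF that] L[of "length I"] by (intro length_code) (force simp: good_def)
      also have "\<dots> \<le> f (length I)"
        using msg[OF that] unfolding f_def good_def by (intro add_mono mult_mono) auto
      finally show ?thesis
        using run_plan[OF that, of "msg I"] msg[OF that] by (auto simp: good_def orc_def intro: le_trans)
    qed
    have "ereal (opt I) / ereal (gain knapsack_alg (orc I) I) \<le> ereal (1 + \<epsilon> (length I))"
      if I: "valid_items I" "has_opt I" for I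
    proof (rule ratio_le[OF K])
      show "(1 - 2 / real (K (length I))) * opt I \<le> gain knapsack_alg (orc I) I"
        using run[OF I(1)] msg[OF I(1)] I(2) by (auto simp: good_def gain_eq)
    qed (use \<epsilon> opt_nonneg[OF I(2)] in auto)
    then have ratio: "competitive_ratio knapsack_alg orc n \<le> ereal (1 + \<epsilon> n)" for n
      unfolding competitive_ratio_def by (blast intro: SUP_least)
    have adv: "uses_advice_bits knapsack_alg orc f"
      using run unfolding uses_advice_bits_def by blast
    have bound: "real (f n) \<le> (B + (5 * B + 2) * (6 + 2 * log 2 (5 * B + 2))) *
        ((1 / \<epsilon> n) * log 2 (real n / \<epsilon> n))" if "\<epsilon> n \<le> B \<and> 2 \<le> real n / \<epsilon> n" for n
      using advice_bound[of B "\<epsilon> n" n] B \<epsilon> that unfolding f_def L_def K_def by blast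
    show "online_knapsack_algorithm knapsack_alg \<and> uses_advice_bits knapsack_alg orc f \<and>
      (\<forall>n. competitive_ratio knapsack_alg orc n \<le> ereal (1 + \<epsilon> n)) \<and>
      (\<forall>n. \<epsilon> n \<le> B \<and> 2 \<le> real n / \<epsilon> n \<longrightarrow>
        real (f n) \<le> (B + (5 * B + 2) * (6 + 2 * log 2 (5 * B + 2))) *
          ((1 / \<epsilon> n) * log 2 (real n / \<epsilon> n)))"
      using online_knapsack_alg adv ratio bound by blast
  qed
qed

end
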